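(* Let $k$ be a field of characteristic different from $2$, let $\varepsilon\in\{1,-1\}$, and let $(V,\Psi)$ be a non-degenerate, finite dimensional, $\varepsilon$-symmetric bilinear space over $k$. Suppose there exist an isometry $\gamma$ of $(V,\Psi)$ and a vector $v_0\in V$ such that (i) $\Psi(v_0,v_0)=1+\varepsilon$; (ii) $V$ is generated as a $k$-vector space by $v_0,\gamma v_0,\gamma^2v_0,\ldots$. Then $(V,\Psi)$ is (isometric to) the skew Bezoutian $B^*(w)$ with $w=p/q$, where $q$ is the characteristic polynomial of $\gamma$ and $p$ is the characteristic polynomial of $\gamma\sigma$, with $\sigma$ the $\varepsilon$-reflection associated to $v_0$.
   Context: A bilinear space $(V,\Psi)$ is $\varepsilon$-symmetric if $\Psi(v,u)=\varepsilon\Psi(u,v)$ for all $u,v\in V$. An isometry of $(V,\Psi)$ is an invertible linear map preserving $\Psi$. Characteristic polynomials are taken monic. For $v_0\in V$ with $\Psi(v_0,v_0)=1+\varepsilon$, the $\varepsilon$-reflection associated to $v_0$ is the isometry $\sigma(v):=v-\Psi(v_0,v)\,v_0$. Skew Bezoutian: let $w\in k(T)$ be a rational function, regular at $0$ and $\infty$, satisfying $w(T^{-1})=-\varepsilon w(T)$ and $w(\infty)=1$. Write $w=p/q$ in lowest terms and let $d=\deg w:=\max\{\deg p,\deg q\}$ (so $\deg p=\deg q=d$ and $q(0)\ne 0$). Consider the expansions $w=w_0+w_1T+w_2T^2+\cdots$ at $0$ and $w=w_0^*+w_1^*T^{-1}+w_2^*T^{-2}+\cdots$ at $\infty$. Then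 $B^*(w)$ is the $d\times d$ Toeplitz matrix with entries $\omega_{i-j}$, $0\le i,j\le d-1$, where $\omega_n:=-w_n$ for $n>0$, $\omega_0:=w_0^*-w_0$, and $\omega_n:=w_{-n}^*$ for $n<0$. The skew Bezoutian, as a bilinear space, is the $k$-vector space $k[T,T^{-1}]/(q^* )$, where $q^*(T):=T^{\deg q}q(1/T)$, equipped with the $\varepsilon$-symmetric bilinear form whose Gram matrix in the basis $1,T,\dots,T^{d-1}$ is $B^*(w)$. *)

theory Defs
  imports
    "Jordan_Normal_Form.Char_Poly"
    "HOL-Library.Poly_Mapping"
    "HOL-Computational_Algebra.Fraction_Field"
    "HOL-Computational_Algebra.Polynomial_FPS"
begin

text \<open>Records with explicit carrier are used because one of the spaces below is a quotient
  depending on a polynomial, which is not a type.\<close>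

record ('k, 'v) bilinear_space =
  space_carrier :: "'v set"
  space_add :: "'v \<Rightarrow> 'v \<Rightarrow> 'v"
  space_scale :: "'k \<Rightarrow> 'v \<Rightarrow> 'v"
  space_form :: "'v \<Rightarrow> 'v \<Rightarrow> 'k"

definition is_isometry ::
    "('k, 'v) bilinear_space \<Rightarrow> ('k, 'w) bilinear_space \<Rightarrow> ('v \<Rightarrow> 'w) \<Rightarrow> bool" where
  "is_isometry A B f \<longleftrightarrow>
     bij_betw f (space_carrier A) (space_carrier B) \<and>
     (\<forall>u\<in>space_carrier A. \<forall>v\<in>space_carrier A.
        f (space_add A u v) = space_add B (f u) (f v)) \<and>
     (\<forall>c. \<forall>u\<in>space_carrier A. f (space_scale A c u) = space_scale B c (f u)) \<and>
     (\<forall>u\<in>space_carrier A. \<forall>v\<in>space_carrier A.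
        space_form B (f u) (f v) = space_form A u v)"

definition isometric :: "('k, 'v) bilinear_space \<Rightarrow> ('k, 'w) bilinear_space \<Rightarrow> bool" where
  "isometric A B \<longleftrightarrow> (\<exists>f. is_isometry A B f)"

definition type_space ::
    "('k \<Rightarrow> 'v \<Rightarrow> 'v) \<Rightarrow> ('v \<Rightarrow> 'v \<Rightarrow> 'k) \<Rightarrow> ('k, 'v::ab_group_add) bilinear_space" where
  "type_space scale \<Psi> =
     \<lparr>space_carrier = UNIV, space_add = (+), space_scale = scale, space_form = \<Psi>\<rparr>"

definition bilinear_form ::
    "('k::field \<Rightarrow> 'v \<Rightarrow> 'v) \<Rightarrow> ('v::ab_group_add \<Rightarrow> 'v \<Rightarrow> 'k) \<Rightarrow> bool" where
  "bilinear_form scale \<Psi> \<longleftrightarrow>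
     (\<forall>u. Vector_Spaces.linear scale (*) (\<lambda>v. \<Psi> u v)) \<and>
     (\<forall>v. Vector_Spaces.linear scale (*) (\<lambda>u. \<Psi> u v))"

definition eps_symmetric :: "'k::field \<Rightarrow> ('v \<Rightarrow> 'v \<Rightarrow> 'k) \<Rightarrow> bool" where
  "eps_symmetric \<epsilon> \<Psi> \<longleftrightarrow> (\<forall>u v. \<Psi> v u = \<epsilon> * \<Psi> u v)"

definition nondegenerate :: "('v::zero \<Rightarrow> 'v \<Rightarrow> 'k::zero) \<Rightarrow> bool" where
  "nondegenerate \<Psi> \<longleftrightarrow>
     (\<forall>u. (\<forall>v. \<Psi> u v = 0) \<longrightarrow> u = 0) \<and> (\<forall>v. (\<forall>u. \<Psi> u v = 0) \<longrightarrow> v = 0)"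

definition eps_reflection ::
    "('k \<Rightarrow> 'v \<Rightarrow> 'v) \<Rightarrow> ('v \<Rightarrow> 'v \<Rightarrow> 'k) \<Rightarrow> 'v \<Rightarrow> 'v \<Rightarrow> 'v::ab_group_add" where
  "eps_reflection scale \<Psi> v0 v = v - scale (\<Psi> v0 v) v0"

definition ordered_basis :: "('k::field \<Rightarrow> 'v \<Rightarrow> 'v) \<Rightarrow> 'v::ab_group_add list \<Rightarrow> bool" where
  "ordered_basis scale bs \<longleftrightarrow>
     distinct bs \<and> \<not> module.dependent scale (set bs) \<and> module.span scale (set bs) = UNIV"

text \<open>Column \<open>j\<close> holds the coordinates of the image of the \<open>j\<close>-th basis vector.\<close>

definition endo_matrix ::
    "('k::field \<Rightarrow> 'v \<Rightarrow> 'v) \<Rightarrow> 'v::ab_group_add list \<Rightarrow> ('v \<Rightarrow> 'v) \<Rightarrow> 'k mat" where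
  "endo_matrix scale bs f =
     mat (length bs) (length bs)
       (\<lambda>(i, j). module.representation scale (set bs) (f (bs ! j)) (bs ! i))"

text \<open>The value does not depend on the basis chosen. The library's \<^const>\<open>char_poly\<close> is the
  determinant of \<open>T - A\<close>, hence monic.\<close>

definition endo_char_poly ::
    "('k::field \<Rightarrow> 'v \<Rightarrow> 'v) \<Rightarrow> ('v::ab_group_add \<Rightarrow> 'v) \<Rightarrow> 'k poly" where
  "endo_char_poly scale f = char_poly (endo_matrix scale (SOME bs. ordered_basis scale bs) f)"

text \<open>The field \<open>k(T)\<close> is \<open>'k poly fract\<close>. The denominator is normalised to be monic, which
  makes the fraction in lowest terms unique.\<close>

definition lowest_terms :: "'k::field poly fract \<Rightarrow> 'k poly \<times> 'k poly" where
  "lowest_terms w =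
     (THE (p, q). w = Fract p q \<and> coprime p q \<and> lead_coeff q = 1)"

definition rat_num :: "'k::field poly fract \<Rightarrow> 'k poly" where
  "rat_num w = fst (lowest_terms w)"

definition rat_denom :: "'k::field poly fract \<Rightarrow> 'k poly" where
  "rat_denom w = snd (lowest_terms w)"

definition rat_degree :: "'k::field poly fract \<Rightarrow> nat" where
  "rat_degree w = max (degree (rat_num w)) (degree (rat_denom w))"

definition rat_const :: "'k::field \<Rightarrow> 'k poly fract" where
  "rat_const c = Fract [:c:] 1"

definition rat_var :: "'k::field poly fract" where
  "rat_var = Fract [:0, 1:] 1"

text \<open>The rational function \<open>w(1/T)\<close>, by evaluating numerator and denominator at \<open>1/T\<close> in
  the field \<open>k(T)\<close>.\<close>

definition rat_at_inverse :: "'k::field poly fract \<Rightarrow> 'k poly fract" where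
  "rat_at_inverse w =
     poly (map_poly rat_const (rat_num w)) (inverse rat_var) /
     poly (map_poly rat_const (rat_denom w)) (inverse rat_var)"

text \<open>Behaviour at infinity is read off at \<open>0\<close> in the local parameter \<open>1/T\<close>.\<close>

definition regular_at_zero :: "'k::field poly fract \<Rightarrow> bool" where
  "regular_at_zero w \<longleftrightarrow> poly (rat_denom w) 0 \<noteq> 0"

definition regular_at_infinity :: "'k::field poly fract \<Rightarrow> bool" where
  "regular_at_infinity w \<longleftrightarrow> regular_at_zero (rat_at_inverse w)"

definition expansion_at_zero :: "'k::field poly fract \<Rightarrow> 'k fps" where
  "expansion_at_zero w = fps_of_poly (rat_num w) / fps_of_poly (rat_denom w)"

definition expansion_at_infinity :: "'k::field poly fract \<Rightarrow> 'k fps" where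
  "expansion_at_infinity w = expansion_at_zero (rat_at_inverse w)"

definition bezoutian_admissible :: "'k::field \<Rightarrow> 'k poly fract \<Rightarrow> bool" where
  "bezoutian_admissible \<epsilon> w \<longleftrightarrow>
     regular_at_zero w \<and> regular_at_infinity w \<and>
     rat_at_inverse w = rat_const (- \<epsilon>) * w \<and>
     fps_nth (expansion_at_infinity w) 0 = 1"

definition bezoutian_omega :: "'k::field poly fract \<Rightarrow> int \<Rightarrow> 'k" where
  "bezoutian_omega w n =
     (if n > 0 then - fps_nth (expansion_at_zero w) (nat n)
      else if n = 0 then fps_nth (expansion_at_infinity w) 0 - fps_nth (expansion_at_zero w) 0
      else fps_nth (expansion_at_infinity w) (nat (- n)))"

definition bezoutian_matrix :: "'k::field poly fract \<Rightarrow> 'k mat" where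
  "bezoutian_matrix w =
     mat (rat_degree w) (rat_degree w) (\<lambda>(i, j). bezoutian_omega w (int i - int j))"

text \<open>Laurent polynomials are finitely supported functions on the integers with the convolution
  product.\<close>

type_synonym 'k laurent_poly = "int \<Rightarrow>\<^sub>0 'k"

definition laurent_of_poly :: "'k::field poly \<Rightarrow> 'k laurent_poly" where
  "laurent_of_poly p = (\<Sum>i\<le>degree p. Poly_Mapping.single (int i) (coeff p i))"

text \<open>Cosets modulo the principal ideal generated by \<open>h\<close>. Scaling goes through representatives
  because the pointwise image under \<open>c = 0\<close> is not a coset.\<close>

definition laurent_coset :: "'k::field laurent_poly \<Rightarrow> 'k laurent_poly \<Rightarrow> 'k laurent_poly set" where
  "laurent_coset h f = {g. h dvd g - f}"

definition coset_add ::
    "'k::field laurent_poly \<Rightarrow> 'k laurent_poly set \<Rightarrow> 'k laurent_poly set \<Rightarrow> 'k laurent_poly set" where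
  "coset_add h X Y = (\<Union>x\<in>X. \<Union>y\<in>Y. laurent_coset h (x + y))"

definition coset_scale ::
    "'k::field laurent_poly \<Rightarrow> 'k \<Rightarrow> 'k laurent_poly set \<Rightarrow> 'k laurent_poly set" where
  "coset_scale h c X = (\<Union>x\<in>X. laurent_coset h (Poly_Mapping.single 0 c * x))"

text \<open>Coordinates of a coset in the basis given by the classes of \<open>1, T, \<dots>, T\<^sup>d\<^sup>-\<^sup>1\<close>.\<close>

definition coset_coords :: "nat \<Rightarrow> 'k::field laurent_poly set \<Rightarrow> 'k vec" where
  "coset_coords d X =
     (THE a. a \<in> carrier_vec d \<and> (\<Sum>i<d. Poly_Mapping.single (int i) (a $ i)) \<in> X)"

text \<open>The library's \<^const>\<open>reflect_poly\<close> reverses the coefficients, so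
  \<open>reflect_poly q\<close> is \<open>T\<^sup>n q(1/T)\<close> with \<open>n\<close> the degree of \<open>q\<close>.\<close>

definition skew_bezoutian :: "'k::field poly fract \<Rightarrow> ('k, 'k laurent_poly set) bilinear_space" where
  "skew_bezoutian w =
     (let h = laurent_of_poly (reflect_poly (rat_denom w)); d = rat_degree w in
      \<lparr>space_carrier = range (laurent_coset h),
       space_add = coset_add h,
       space_scale = coset_scale h,
       space_form = (\<lambda>X Y. coset_coords d X \<bullet> (bezoutian_matrix w *\<^sub>v coset_coords d Y))\<rparr>)"

end

theory Submission
  imports Defs
begin

text \<open>Put \<open>c\<^sub>n = \<Psi>(v0, \<gamma>\<^sup>n v0)\<close> for \<open>n \<ge> 0\<close> and \<open>d = dim V\<close>. By cyclicity the vectors \<open>\<gamma>\<^sup>i v0\<close> with \<open>i < d\<close>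
  form a basis. Its Gram matrix is Toeplitz because \<open>\<gamma>\<close> is an isometry: its entries are \<open>c\<^sub>j\<^sub>-\<^sub>i\<close> for
  \<open>i \<le> j\<close> and \<open>\<epsilon> c\<^sub>i\<^sub>-\<^sub>j\<close> for \<open>i > j\<close>. So it suffices that this is the matrix attached to \<open>w = p/q\<close> and that
  \<open>1, T, \<dots>, T\<^sup>d\<^sup>-\<^sup>1\<close> represent a basis of the Laurent polynomials modulo the reversed \<open>q\<close>; the linear map
  \<open>\<gamma>\<^sup>i v0 \<mapsto> T\<^sup>i\<close>, \<open>i < d\<close>, is then the required isometry.

  The link between \<open>w\<close> and the moments \<open>c\<^sub>n\<close> is that \<open>\<gamma>\<sigma> = \<gamma> - \<Psi>(v0, _) \<gamma> v0\<close> is a perturbation of \<open>\<gamma>\<close> of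
  rank one, whence \<open>w = 1 + \<Psi>(v0, (T - \<gamma>)\<^sup>-\<^sup>1 \<gamma> v0)\<close> (lemma \<open>coeff_p\<close>). Expanding the resolvent at infinity
  gives \<open>1 + \<Sum> c\<^sub>n T\<^sup>-\<^sup>n\<close> over \<open>n \<ge> 1\<close>, and expanding it at 0 gives \<open>-\<epsilon> (1 + \<Sum> c\<^sub>n T\<^sup>n\<close>) (lemmas
  \<open>reflect_p_expansion\<close> and \<open>p_expansion\<close>). Comparing the two yields both the functional equation
  \<open>w(1/T) = -\<epsilon> w(T)\<close> and the identity of \<open>B\<^sup>*(w)\<close> with the Gram matrix.

  All of this presupposes that \<open>p/q\<close> is in lowest terms, since degree and denominator of \<open>w\<close> enter the
  definition of the Bezoutian. Here non-degeneracy is essential: a cancellation would make the moments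
  satisfy a linear recurrence shorter than \<open>d\<close>, producing a nonzero vector orthogonal to the whole
  space (lemma \<open>coprime_p_q\<close>).\<close>

section \<open>Cayley-Hamilton and cyclic vectors\<close>

definition poly_act :: "('k::field \<Rightarrow> 'v \<Rightarrow> 'v) \<Rightarrow> ('v \<Rightarrow> 'v) \<Rightarrow> 'k poly \<Rightarrow> 'v \<Rightarrow> 'v::ab_group_add" where
  "poly_act scale f P v = (\<Sum>i\<le>degree P. scale (coeff P i) ((f ^^ i) v))"

context finite_dimensional_vector_space
begin

lemma linear_funpow:
  assumes "Vector_Spaces.linear scale scale f"
  shows "Vector_Spaces.linear scale scale (f ^^ i)"
proof (induction i)
  case 0
  show ?case using module_hom_id by (simp add: id_def)
next
  case (Suc i)
  from Vector_Spaces.linear_compose[OF this assms] show ?case by (simp only: funpow.simps)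
qed

lemma poly_act_eq:
  assumes "degree P \<le> N"
  shows "poly_act scale f P v = (\<Sum>i\<le>N. scale (coeff P i) ((f ^^ i) v))"
  unfolding poly_act_def
  using assms by (intro sum.mono_neutral_left) (auto simp: coeff_eq_0)

text \<open>Read \<open>r\<close> as the coefficients of a vector polynomial \<open>r(T)\<close> with
  \<open>(T - f) r(T) = a(T) v\<close>. Substituting \<open>f\<close> for \<open>T\<close> kills the left side; stopping the
  substitution at degree \<open>K\<close> leaves one boundary term.\<close>

lemma horner_telescope:
  assumes lin: "Vector_Spaces.linear scale scale f"
    and r0: "f (r 0) = - scale (a 0) v"
    and rS: "\<And>m. r m - f (r (Suc m)) = scale (a (Suc m)) v"
  shows "(\<Sum>m\<le>K. scale (a m) ((f ^^ m) v)) = - (f ^^ Suc K) (r K)"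
proof (induction K)
  case 0
  then show ?case by (simp add: r0)
next
  case (Suc K)
  interpret fn: Vector_Spaces.linear scale scale "f ^^ Suc K" by (rule linear_funpow[OF lin])
  have "scale (a (Suc K)) ((f ^^ Suc K) v) = (f ^^ Suc K) (r K - f (r (Suc K)))"
    unfolding rS fn.scale ..
  also have "\<dots> = (f ^^ Suc K) (r K) - (f ^^ Suc (Suc K)) (r (Suc K))"
    unfolding fn.diff by (simp add: funpow_swap1)
  finally show ?case unfolding sum.atMost_Suc Suc.IH by simp
qed

lemma ordered_basis_exists: "\<exists>bs. ordered_basis scale bs"
proof -
  obtain bs where "set bs = Basis" "distinct bs"
    using finite_distinct_list[OF finite_Basis] by blast
  then show ?thesis unfolding ordered_basis_def
    using independent_Basis span_Basis by metis
qed

lemma ordered_basis_length: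
  assumes "ordered_basis scale bs"
  shows "length bs = dimension"
  using assms unfolding ordered_basis_def dimension_def
  by (metis basis_card_eq_dim dim_UNIV distinct_card subset_UNIV order_refl)

lemma endo_char_poly_degree:
  "degree (endo_char_poly scale f) = dimension" 
  "coeff (endo_char_poly scale f) dimension = 1"
proof -
  define bs where "bs = (SOME bs. ordered_basis scale bs)"
  have b: "ordered_basis scale bs" unfolding bs_def by (rule someI_ex[OF ordered_basis_exists])
  have "endo_matrix scale bs f \<in> carrier_mat dimension dimension"
    unfolding endo_matrix_def ordered_basis_length[OF b, symmetric] by simp
  from degree_monic_char_poly[OF this]
  show "degree (endo_char_poly scale f) = dimension" 
    "coeff (endo_char_poly scale f) dimension = 1"
    unfolding endo_char_poly_def bs_def by auto
qed

text \<open>The vector polynomial \<open>r(T) = adj(T - f) v\<close> solves \<open>(T - f) r(T) = q(T) v\<close>; it is stated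
  here coefficient by coefficient, so that the matrix entries over \<open>k[T]\<close> disappear from view.\<close>

lemma adjugate_recursion:
  assumes lin: "Vector_Spaces.linear scale scale f" and b: "ordered_basis scale bs"
  defines "q \<equiv> char_poly (endo_matrix scale bs f)"
  obtains r N where "f (r 0) = - scale (coeff q 0) v"
    "\<And>m. r m - f (r (Suc m)) = scale (coeff q (Suc m)) v"
    "\<And>m. m \<ge> N \<Longrightarrow> r m = 0"
proof -
  interpret f: Vector_Spaces.linear scale scale f by fact
  define n where "n = length bs"
  define A where "A = endo_matrix scale bs f"
  have A: "A \<in> carrier_mat n n" unfolding A_def endo_matrix_def n_def by simp
  have dist: "distinct bs" and indep: "independent (set bs)" and spn: "span (set bs) = UNIV"
    using b unfolding ordered_basis_def by auto
  have expand: "(\<Sum>i<n. scale (representation (set bs) u (bs ! i)) (bs ! i)) = u" for u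
  proof -
    have "(\<Sum>i<n. scale (representation (set bs) u (bs ! i)) (bs ! i)) 
        = (\<Sum>x\<in>set bs. scale (representation (set bs) u x) x)"
      unfolding n_def
      by (rule sum.reindex_bij_betw[OF bij_betw_nth[OF dist refl refl]])
    also have "\<dots> = u"
      by (rule sum_representation_eq[OF indep]) (auto simp: spn)
    finally show ?thesis .
  qed
  have fb: "f (bs ! j) = (\<Sum>i<n. scale (A $$ (i,j)) (bs ! i))" if "j < n" for j
    using that expand[of "f (bs ! j)"] unfolding A_def endo_matrix_def n_def by simp
  define x where "x i = representation (set bs) v (bs ! i)" for i
  define M where "M = char_poly_matrix A"
  have M: "M \<in> carrier_mat n n" unfolding M_def using A by simp
  \<comment> \<open>The vector polynomial \<open>adj(T - A) x\<close>, in coordinates.\<close>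
  define R where "R = adj_mat M *\<^sub>v vec n (\<lambda>i. [:x i:])"
  have R: "R \<in> carrier_vec n" unfolding R_def using adj_mat(1)[OF M] by simp
  have "M *\<^sub>v R = q \<cdot>\<^sub>v vec n (\<lambda>i. [:x i:])"
  proof -
    have "M *\<^sub>v R = (M * adj_mat M) *\<^sub>v vec n (\<lambda>i. [:x i:])"
      unfolding R_def by (rule assoc_mult_mat_vec[symmetric, OF M adj_mat(1)[OF M]]) simp
    also have "M * adj_mat M = q \<cdot>\<^sub>m 1\<^sub>m n"
      using adj_mat(2)[OF M] unfolding q_def char_poly_def M_def A_def .
    also have "\<dots> *\<^sub>v vec n (\<lambda>i. [:x i:]) = q \<cdot>\<^sub>v vec n (\<lambda>i. [:x i:])"
      by (intro eq_vecI) (auto simp: scalar_prod_def if_distrib if_distribR sum.delta cong: if_cong)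
    finally show ?thesis .
  qed
  then have row: "(M *\<^sub>v R) $ i = q * [:x i:]" if "i < n" for i
    using that by simp
  have rowR: "[:0,1:] * R $ i - (\<Sum>j<n. [:A $$ (i,j):] * R $ j) = Polynomial.smult (x i) q" if i: "i < n" for i
  proof -
    have "(M *\<^sub>v R) $ i = (\<Sum>j<n. M $$ (i,j) * R $ j)"
      using i M R by (auto simp: scalar_prod_def atLeast0LessThan)
    also have "\<dots> = (\<Sum>j<n. (if i = j then [:0,1:] * R $ j else 0) - [:A $$ (i,j):] * R $ j)"
      by (rule sum.cong) (use i A in \<open>auto simp: M_def char_poly_matrix_def algebra_simps\<close>)
    also have "\<dots> = [:0,1:] * R $ i - (\<Sum>j<n. [:A $$ (i,j):] * R $ j)"
      unfolding sum_subtractf using i by simp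
    finally show ?thesis using row[OF i] by simp
  qed
  define r where "r m = (\<Sum>i<n. scale (coeff (R $ i) m) (bs ! i))" for m
  have fr: "f (r m) = (\<Sum>i<n. scale (\<Sum>j<n. A $$ (i,j) * coeff (R $ j) m) (bs ! i))" for m
  proof -
    have "f (r m) = (\<Sum>j<n. scale (coeff (R $ j) m) (f (bs ! j)))"
      unfolding r_def by (simp add: f.sum f.scale)
    also have "\<dots> = (\<Sum>j<n. \<Sum>i<n. scale (A $$ (i,j) * coeff (R $ j) m) (bs ! i))"
      by (simp add: fb scale_sum_right mult.commute)
    also have "\<dots> = (\<Sum>i<n. \<Sum>j<n. scale (A $$ (i,j) * coeff (R $ j) m) (bs ! i))"
      by (rule sum.swap)
    finally show ?thesis by (simp add: scale_sum_left)
  qed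
  have vx: "v = (\<Sum>i<n. scale (x i) (bs ! i))" unfolding x_def expand ..
  show thesis
  proof
    have "(\<Sum>j<n. A $$ (i,j) * coeff (R $ j) 0) = - (coeff q 0 * x i)" if "i < n" for i
      using arg_cong[OF rowR[OF that], of "\<lambda>P. coeff P 0"] by (simp add: coeff_sum mult.commute neg_eq_iff_add_eq_0 eq_neg_iff_add_eq_0 add.commute)
    then show "f (r 0) = - scale (coeff q 0) v"
      unfolding fr by (subst vx) (simp add: scale_sum_right sum_negf)
    fix m
    have "coeff (R $ i) m - (\<Sum>j<n. A $$ (i,j) * coeff (R $ j) (Suc m)) = coeff q (Suc m) * x i" if "i < n" for i
      using arg_cong[OF rowR[OF that], of "\<lambda>P. coeff P (Suc m)"] by (simp add: coeff_sum mult.commute)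
    then have "(\<Sum>i<n. scale (coeff (R $ i) m - (\<Sum>j<n. A $$ (i,j) * coeff (R $ j) (Suc m))) (bs ! i)) = scale (coeff q (Suc m)) v"
      by (subst vx) (simp add: scale_sum_right)
    then show "r m - f (r (Suc m)) = scale (coeff q (Suc m)) v"
      unfolding fr by (simp add: r_def scale_left_diff_distrib sum_subtractf)
  next
    \<comment> \<open>The sum of the degrees is a crude common bound for them.\<close>
    fix m assume m: "m \<ge> Suc (\<Sum>i<n. degree (R $ i))"
    have "coeff (R $ i) m = 0" if "i < n" for i
    proof (rule coeff_eq_0)
      have "degree (R $ i) \<le> (\<Sum>i<n. degree (R $ i))"
        by (rule member_le_sum) (use that in auto)
      with m show "degree (R $ i) < m" by simp
    qed
    then show "r m = 0" unfolding r_def by simp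
  qed
qed

text \<open>Since the solution \<open>r(T)\<close> has finite degree, its boundary term vanishes for large \<open>K\<close>.\<close>

lemma cayley_hamilton:
  assumes lin: "Vector_Spaces.linear scale scale f"
  shows "poly_act scale f (endo_char_poly scale f) v = 0"
proof -
  define bs where "bs = (SOME bs. ordered_basis scale bs)"
  have b: "ordered_basis scale bs" unfolding bs_def by (rule someI_ex[OF ordered_basis_exists])
  define q where "q = endo_char_poly scale f"
  have q: "q = char_poly (endo_matrix scale bs f)" unfolding q_def endo_char_poly_def bs_def ..
  obtain r N where r: "f (r 0) = - scale (coeff q 0) v"
    "\<And>m. r m - f (r (Suc m)) = scale (coeff q (Suc m)) v" "\<And>m. m \<ge> N \<Longrightarrow> r m = 0"
    using adjugate_recursion[OF lin b, of v] unfolding q by metis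
  define K where "K = max N (degree q)"
  have "poly_act scale f q v = - (f ^^ Suc K) (r K)"
    using horner_telescope[OF lin r(1,2), where K = K] poly_act_eq[of q K f v] by (simp add: K_def)
  also have "r K = 0" by (rule r(3)) (simp add: K_def)
  finally show ?thesis
    using module_hom.zero[OF Vector_Spaces.linear.axioms(3)[OF linear_funpow[OF lin]], of "Suc K"]
    unfolding q_def by (simp del: funpow.simps)
qed

lemma spanning_family_independent:
  assumes spn: "span (x ` {..<dimension}) = UNIV"
    and eq: "(\<Sum>i<dimension. scale (a i) (x i)) = 0" and i: "i < dimension"
  shows "a i = 0"
proof -
  have d: "dim UNIV = dimension" unfolding dimension_def by simp
  have "dimension \<le> card (x ` {..<dimension})"
    using dim_le_card[of UNIV "x ` {..<dimension}"] spn d by simp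
  moreover have "card (x ` {..<dimension}) \<le> dimension"
    using card_image_le[of "{..<dimension}" x] by simp
  ultimately have c: "card (x ` {..<dimension}) = dimension" by simp
  then have inj: "inj_on x {..<dimension}" by (intro eq_card_imp_inj_on) auto
  have indep: "independent (x ` {..<dimension})"
    using card_le_dim_spanning[of "x ` {..<dimension}" UNIV] spn c d by simp
  have "(\<Sum>y\<in>x ` {..<dimension}. scale (a (the_inv_into {..<dimension} x y)) y) = 0"
    using eq by (subst sum.reindex[OF inj]) (simp add: the_inv_into_f_f[OF inj])
  then have "a (the_inv_into {..<dimension} x (x i)) = 0"
    using independentD[OF indep, of "x ` {..<dimension}" "\<lambda>y. a (the_inv_into {..<dimension} x y)" "x i"] i by blast
  then show ?thesis using the_inv_into_f_f[OF inj] i by simp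
qed

lemma spanning_family_coords:
  assumes spn: "span (x ` {..<N::nat}) = UNIV"
  obtains a where "u = (\<Sum>i<N. scale (a i) (x i))"
proof -
  have "u \<in> span (x ` {..<N})" using spn by simp
  then have "\<exists>a. u = (\<Sum>i<N. scale (a i) (x i))"
  proof (induction rule: span_induct_alt)
    case base
    show ?case by (rule exI[of _ "\<lambda>_. 0"]) simp
  next
    case (step c y z)
    then obtain i a where i: "i < N" "y = x i" "z = (\<Sum>i<N. scale (a i) (x i))" by auto
    have "scale c y + z = (\<Sum>j<N. scale (if j = i then c else 0) (x j)) + (\<Sum>j<N. scale (a j) (x j))"
      using i by (simp add: if_distrib[of "\<lambda>c. scale c _"] cong: if_cong)
    also have "\<dots> = (\<Sum>j<N. scale ((if j = i then c else 0) + a j) (x j))"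
      by (simp add: scale_left_distrib sum.distrib)
    finally show ?case by (rule exI[of _ "\<lambda>j. (if j = i then c else 0) + a j"])
  qed
  then show thesis using that by blast
qed

text \<open>By Cayley-Hamilton the span of the first \<open>dim V\<close> vectors of an orbit is already stable under
  \<open>f\<close>, so a cyclic vector yields a basis of consecutive powers.\<close>

lemma orbit_spans:
  assumes lin: "Vector_Spaces.linear scale scale f"
    and spn: "span (range (\<lambda>i. (f ^^ i) v)) = UNIV"
  shows "span ((\<lambda>i. (f ^^ i) v) ` {..<dimension}) = UNIV"
proof -
  interpret f: Vector_Spaces.linear scale scale f by fact
  define S where "S = span ((\<lambda>i. (f ^^ i) v) ` {..<dimension})"
  define q where "q = endo_char_poly scale f"
  have sub: "subspace S" unfolding S_def by (rule subspace_span)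
  have mem: "(f ^^ i) v \<in> S" if "i < dimension" for i
    unfolding S_def by (rule span_base) (use that in auto)
  have top: "(f ^^ dimension) v \<in> S"
  proof -
    have "0 = (\<Sum>i\<le>dimension. scale (coeff q i) ((f ^^ i) v))"
      using cayley_hamilton[OF lin, of v] poly_act_eq[of q dimension f v] 
      by (simp add: q_def endo_char_poly_degree)
    also have "\<dots> = (\<Sum>i<dimension. scale (coeff q i) ((f ^^ i) v)) + (f ^^ dimension) v"
      unfolding lessThan_Suc_atMost[symmetric] by (simp add: q_def endo_char_poly_degree)
    finally have "(f ^^ dimension) v = - (\<Sum>i<dimension. scale (coeff q i) ((f ^^ i) v))"
      by (simp add: eq_neg_iff_add_eq_0 add.commute)
    also have "\<dots> \<in> S"
      by (intro subspace_neg subspace_sum subspace_scale sub mem) auto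
    finally show ?thesis .
  qed
  have inv: "f u \<in> S" if "u \<in> S" for u
    using that unfolding S_def
  proof (induction rule: span_induct_alt)
    case base
    show ?case by (simp add: f.zero span_zero)
  next
    case (step c y z)
    then obtain i where i: "i < dimension" "y = (f ^^ i) v" by auto
    have "f y \<in> S" using mem[of "Suc i"] top i by (cases "Suc i < dimension") (auto simp: not_less_eq less_Suc_eq simp flip: funpow.simps(2) o_apply[of f "f ^^ i"])
    then show ?case using step by (simp add: f.add f.scale span_add span_scale S_def)
  qed
  have "(f ^^ i) v \<in> S" for i
  proof (induction i)
    case 0
    show ?case using mem[of 0] top by (cases "dimension = 0") auto
  next
    case (Suc i)
    then show ?case using inv by simp
  qed
  then have "span (range (\<lambda>i. (f ^^ i) v)) \<subseteq> S"
    by (intro span_minimal sub) auto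
  then show ?thesis using spn unfolding S_def by auto
qed

end

section \<open>Rational functions in lowest terms\<close>

text \<open>The Euclidean algorithm: remainders stay in the ideal generated by \<open>p\<close> and \<open>q\<close>.\<close>

lemma poly_bezout:
  fixes p q :: "'k::field poly"
  shows "\<exists>g a b. g = a * p + b * q \<and> g dvd p \<and> g dvd q"
proof (induction "if q = 0 then 0 else Suc (degree q)" arbitrary: p q rule: less_induct)
  case less
  show ?case
  proof (cases "q = 0")
    case True
    then show ?thesis by (intro exI[of _ p] exI[of _ 1] exI[of _ 0]) simp
  next
    case False
    have "(if p mod q = 0 then 0 else Suc (degree (p mod q))) < (if q = 0 then 0 else Suc (degree q))"
      using degree_mod_less[of q p] False by auto
    from less[OF this] obtain g a b where g: "g = a * q + b * (p mod q)" "g dvd q" "g dvd p mod q"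
      by blast
    have "g = b * p + (a - b * (p div q)) * q"
      unfolding g(1) minus_mult_div_eq_mod[symmetric] by (simp add: algebra_simps)
    moreover have "g dvd p" using g(2,3) dvd_mod_iff by blast
    ultimately show ?thesis using g(2) by blast
  qed
qed

lemma coprime_poly_dvd_mult_cancel:
  fixes p q r :: "'k::field poly"
  assumes "coprime p q" "q dvd p * r"
  shows "q dvd r"
proof -
  obtain g a b where g: "g = a * p + b * q" "g dvd p" "g dvd q"
    using poly_bezout by blast
  have "g dvd 1" using g(2,3) assms(1) coprime_common_divisor by blast
  then obtain c where c: "1 = g * c" by (elim dvdE)
  have "r = c * a * (p * r) + c * b * r * q"
    using arg_cong[OF c, of "\<lambda>x. x * r"] unfolding g(1) by (simp add: algebra_simps)
  also have "q dvd \<dots>" by (intro dvd_add dvd_mult[OF assms(2)] dvd_triv_right)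
  finally show ?thesis .
qed

text \<open>Two coprime representations of a fraction have denominators dividing each other; being monic,
  the denominators agree.\<close>

lemma lowest_terms_Fract:
  fixes p q :: "'k::field poly"
  assumes "coprime p q" "lead_coeff q = 1"
  shows "lowest_terms (Fract p q) = (p, q)"
  unfolding lowest_terms_def
proof (rule the_equality)
  show "case (p, q) of (p', q') \<Rightarrow> Fract p q = Fract p' q' \<and> coprime p' q' \<and> lead_coeff q' = 1"
    using assms by simp
next
  fix x assume "case x of (p', q') \<Rightarrow> Fract p q = Fract p' q' \<and> coprime p' q' \<and> lead_coeff q' = 1"
  then obtain p' q' where x: "x = (p', q')" and eq: "Fract p q = Fract p' q'"
    and cop: "coprime p' q'" and lc: "lead_coeff q' = 1"
    by (cases x) auto
  have nz: "q \<noteq> 0" "q' \<noteq> 0" using assms(2) lc by auto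
  have e: "p * q' = p' * q" using eq nz by (simp add: eq_fract)
  have "q dvd q'" by (rule coprime_poly_dvd_mult_cancel[OF assms(1)]) (simp add: e)
  moreover have "q' dvd q" by (rule coprime_poly_dvd_mult_cancel[OF cop]) (simp flip: e)
  ultimately have "q = q'" using assms(2) lc by (intro poly_dvd_antisym) auto
  then show "x = (p, q)" using e nz x by simp
qed

lemma Fract_sum_1: "Fract (sum f A) 1 = (\<Sum>i\<in>A. Fract (f i :: 'k::field poly) 1)"
proof (induction A rule: infinite_finite_induct)
  case (insert x A)
  have "Fract (sum f (insert x A)) 1 = Fract (f x) 1 + Fract (sum f A) 1"
    using insert(1,2) by simp
  then show ?case
    unfolding insert.IH sum.insert[OF insert(1,2), of "\<lambda>i. Fract (f i) 1"] .
qed (simp_all add: Zero_fract_def)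

lemma reflect_poly_as_sum: "reflect_poly p = (\<Sum>i\<le>degree p. monom (coeff p i) (degree p - i))"
proof (rule poly_eqI)
  fix m
  have "coeff (\<Sum>i\<le>degree p. monom (coeff p i) (degree p - i)) m 
      = (\<Sum>i\<le>degree p. if i = degree p - m \<and> m \<le> degree p then coeff p i else 0)"
    unfolding coeff_sum by (rule sum.cong) auto
  then show "coeff (reflect_poly p) m = coeff (\<Sum>i\<le>degree p. monom (coeff p i) (degree p - i)) m"
    by (cases "m \<le> degree p") (auto simp: coeff_reflect_poly)
qed

lemma rat_var_power: "rat_var ^ m = Fract (monom 1 m) (1 :: 'k::field poly)"
  by (induction m) (auto simp: rat_var_def One_fract_def monom_Suc monom_0 one_pCons)

text \<open>Clearing denominators in \<open>p(1/T)\<close> reverses the coefficients.\<close>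

lemma poly_at_inverse_rat_var:
  fixes p :: "'k::field poly"
  shows "poly (map_poly rat_const p) (inverse rat_var) * rat_var ^ degree p = Fract (reflect_poly p) 1"
proof -
  have nz: "(rat_var :: 'k poly fract) \<noteq> 0"
    by (simp add: rat_var_def Zero_fract_def eq_fract)
  have c0: "rat_const c = 0 \<longleftrightarrow> c = 0" for c :: 'k
    by (simp add: rat_const_def Zero_fract_def eq_fract)
  have "poly (map_poly rat_const p) (inverse rat_var) * rat_var ^ degree p
      = (\<Sum>i\<le>degree p. rat_const (coeff p i) * inverse rat_var ^ i) * rat_var ^ degree p"
    by (subst poly_altdef) (simp add: c0 degree_map_poly coeff_map_poly)
  also have "\<dots> = (\<Sum>i\<le>degree p. Fract (monom (coeff p i) (degree p - i)) 1)"
    unfolding sum_distrib_right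
  proof (rule sum.cong[OF refl])
    fix i assume "i \<in> {..degree p}"
    then have "inverse rat_var ^ i * rat_var ^ degree p = (rat_var :: 'k poly fract) ^ (degree p - i)"
      using nz by (simp add: power_diff power_inverse field_simps)
    then show "rat_const (coeff p i) * inverse rat_var ^ i * rat_var ^ degree p
        = Fract (monom (coeff p i) (degree p - i)) 1"
      by (simp add: mult.assoc rat_var_power rat_const_def smult_monom)
  qed
  also have "\<dots> = Fract (reflect_poly p) 1"
    unfolding reflect_poly_as_sum Fract_sum_1 ..
  finally show ?thesis .
qed

lemma rat_at_inverse_Fract:
  fixes p q :: "'k::field poly"
  assumes "coprime p q" "lead_coeff q = 1" "degree p = degree q"
  shows "rat_at_inverse (Fract p q) = Fract (reflect_poly p) (reflect_poly q)"
proof -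
  have nz: "(rat_var :: 'k poly fract) ^ degree q \<noteq> 0"
    by (simp add: rat_var_power Zero_fract_def eq_fract)
  have "rat_at_inverse (Fract p q)
      = (poly (map_poly rat_const p) (inverse rat_var) * rat_var ^ degree p) /
        (poly (map_poly rat_const q) (inverse rat_var) * rat_var ^ degree q)"
    unfolding rat_at_inverse_def rat_num_def rat_denom_def lowest_terms_Fract[OF assms(1,2)] assms(3)
    using nz by simp
  also have "\<dots> = Fract (reflect_poly p) (reflect_poly q)"
    unfolding poly_at_inverse_rat_var by simp
  finally show ?thesis .
qed

section \<open>Laurent polynomials modulo a polynomial with nonzero constant term\<close>

lemma laurent_of_poly_eq:
  assumes "degree p \<le> N"
  shows "laurent_of_poly p = (\<Sum>i\<le>N. Poly_Mapping.single (int i) (coeff p i))"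
  unfolding laurent_of_poly_def
  using assms by (intro sum.mono_neutral_left) (auto simp: coeff_eq_0)

lemma laurent_of_poly_add: "laurent_of_poly (p + q) = laurent_of_poly p + laurent_of_poly q"
proof -
  define N where "N = max (degree p) (degree q)"
  have "degree (p + q) \<le> N" "degree p \<le> N" "degree q \<le> N"
    unfolding N_def by (auto intro: degree_add_le)
  then show ?thesis by (simp add: laurent_of_poly_eq[of _ N] single_add sum.distrib)
qed

lemma laurent_of_poly_smult:
  "laurent_of_poly (Polynomial.smult c p) = Poly_Mapping.single 0 c * laurent_of_poly p"
  by (subst laurent_of_poly_eq[of _ "degree p"]) (simp_all add: laurent_of_poly_def sum_distrib_left mult_single)

lemma laurent_of_poly_pCons:
  "laurent_of_poly (pCons a p) = Poly_Mapping.single 0 a + Poly_Mapping.single 1 1 * laurent_of_poly p"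
  by (subst laurent_of_poly_eq[of _ "Suc (degree p)"])
    (simp_all add: laurent_of_poly_def sum_distrib_left mult_single degree_pCons_le
      sum.atMost_Suc_shift del: sum.atMost_Suc)

lemma laurent_of_poly_0 [simp]: "laurent_of_poly 0 = 0"
  by (simp add: laurent_of_poly_def)

lemma laurent_of_poly_mult: "laurent_of_poly (p * q) = laurent_of_poly p * laurent_of_poly q"
  by (induction p)
    (simp_all add: laurent_of_poly_pCons laurent_of_poly_add laurent_of_poly_smult distrib_right mult.assoc)

lemma laurent_of_poly_diff: "laurent_of_poly (p - q) = laurent_of_poly p - laurent_of_poly q"
  using laurent_of_poly_add[of "p - q" q] by simp

lemma laurent_of_poly_monom: "laurent_of_poly (monom c i) = Poly_Mapping.single (int i) c"
  by (subst laurent_of_poly_eq[of _ i])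
    (simp_all add: degree_monom_le if_distrib[of "Poly_Mapping.single _"] cong: if_cong)

lemma laurent_of_poly_sum: "laurent_of_poly (sum f A) = (\<Sum>i\<in>A. laurent_of_poly (f i))"
  by (induction A rule: infinite_finite_induct) (auto simp: laurent_of_poly_add)

lemma laurent_of_poly_inject: "laurent_of_poly p = laurent_of_poly q \<longleftrightarrow> p = q"
proof
  have l: "Poly_Mapping.lookup (laurent_of_poly p) (int i) = coeff p i" for p :: "'k::field poly" and i
  proof -
    have "Poly_Mapping.lookup (laurent_of_poly p) (int i) 
        = (\<Sum>j\<le>max i (degree p). if j = i then coeff p j else 0)"
      by (subst laurent_of_poly_eq[of p "max i (degree p)"])
        (auto simp: lookup_sum lookup_single when_def intro!: sum.cong)
    then show ?thesis by simp
  qed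
  assume "laurent_of_poly p = laurent_of_poly q"
  then show "p = q" by (metis l poly_eqI)
qed simp

text \<open>Multiplication by a high power of the unit \<open>T\<close> moves the support into the nonnegative
  exponents; this reduces divisibility of Laurent polynomials to divisibility of polynomials.\<close>

lemma laurent_shift_poly:
  fixes f :: "'k::field laurent_poly"
  shows "\<exists>N F. Poly_Mapping.single (int N) 1 * f = laurent_of_poly F"
proof (induction f rule: update_induct)
  case const
  have "Poly_Mapping.single (int 0) 1 * 0 = laurent_of_poly (0 :: 'k poly)" by simp
  then show ?case by blast
next
  case (update f k c)
  define M where "M = nat (- k)"
  define g where "g = Poly_Mapping.single k c"
  define G where "G = monom c (nat (k + int M))"
  have G: "Poly_Mapping.single (int M) 1 * g = laurent_of_poly G"
    by (auto simp: g_def G_def M_def mult_single laurent_of_poly_monom)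
  obtain N F where F: "Poly_Mapping.single (int N) 1 * f = laurent_of_poly F"
    using update by blast
  have upd: "Poly_Mapping.update k c f = f + g"
    using update(1) unfolding g_def
    by (intro poly_mapping_eqI) (auto simp: lookup_update lookup_add lookup_single in_keys_iff when_def)
  have s: "Poly_Mapping.single (int (M + N)) (1::'k) = Poly_Mapping.single (int M) 1 * Poly_Mapping.single (int N) 1"
    by (simp add: mult_single)
  have "Poly_Mapping.single (int (M + N)) 1 * (f + g) 
     = Poly_Mapping.single (int M) 1 * (Poly_Mapping.single (int N) 1 * f)
     + Poly_Mapping.single (int N) 1 * (Poly_Mapping.single (int M) 1 * g)"
    unfolding s by (simp add: algebra_simps)
  also have "\<dots> = laurent_of_poly (monom 1 M * F + monom 1 N * G)"
    by (simp add: F G laurent_of_poly_add laurent_of_poly_mult laurent_of_poly_monom)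
  finally show ?case unfolding upd by blast
qed

text \<open>If \<open>s(0) \<noteq> 0\<close> then \<open>s\<close> is coprime to \<open>T\<close>.\<close>

lemma dvd_monom_mult_cancel:
  fixes s a :: "'k::field poly"
  assumes "coeff s 0 \<noteq> 0" "s dvd monom 1 N * a"
  shows "s dvd a"
  using assms(2)
proof (induction N)
  case 0
  then show ?case by simp
next
  case (Suc N)
  from Suc.prems obtain G where "monom 1 (Suc N) * a = s * G" by (elim dvdE)
  then have G: "pCons 0 (monom 1 N * a) = s * G" by (simp add: monom_Suc)
  obtain g0 G' where G': "G = pCons g0 G'" by (cases G)
  have "coeff s 0 * g0 = 0" using arg_cong[OF G, of "\<lambda>x. coeff x 0"] by (auto simp: G' coeff_mult)
  then have "G = pCons 0 G'" using assms(1) G' by simp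
  then have "monom 1 N * a = s * G'" using G by simp
  then show ?case using Suc.IH by auto
qed

text \<open>A Laurent multiple of \<open>s\<close> that happens to be a polynomial is a polynomial multiple of \<open>s\<close>, hence
  zero if its degree is below that of \<open>s\<close>. With the next lemma this says that the classes of
  \<open>1, \<dots>, T\<^sup>d\<^sup>-\<^sup>1\<close> form a basis of the quotient by \<open>s\<close>.\<close>

lemma laurent_rep_unique:
  fixes s :: "'k::field poly"
  assumes "coeff s 0 \<noteq> 0"
    and dvd: "laurent_of_poly s dvd (\<Sum>i<degree s. Poly_Mapping.single (int i) (a i)) - (\<Sum>i<degree s. Poly_Mapping.single (int i) (b i))"
    and i: "i < degree s"
  shows "a i = b i"
proof -
  define P where "P = (\<Sum>i<degree s. monom (a i - b i) i)"
  have "(\<Sum>i<degree s. Poly_Mapping.single (int i) (a i)) - (\<Sum>i<degree s. Poly_Mapping.single (int i) (b i)) = laurent_of_poly P"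
    unfolding P_def laurent_of_poly_sum laurent_of_poly_monom by (simp add: single_diff sum_subtractf)
  with dvd obtain g where g: "laurent_of_poly P = laurent_of_poly s * g" by (auto elim: dvdE)
  obtain N G where G: "Poly_Mapping.single (int N) 1 * g = laurent_of_poly G"
    using laurent_shift_poly by blast
  have "laurent_of_poly (monom 1 N * P) = laurent_of_poly (s * G)"
    unfolding laurent_of_poly_mult laurent_of_poly_monom g G[symmetric] by (simp add: ac_simps)
  then have "s dvd monom 1 N * P" unfolding laurent_of_poly_inject by simp
  then have sP: "s dvd P" by (rule dvd_monom_mult_cancel[OF assms(1)])
  have cP: "coeff P j = (if j < degree s then a j - b j else 0)" for j
    unfolding P_def coeff_sum by simp
  have "P = 0"
  proof (rule ccontr)
    assume "P \<noteq> 0"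
    then have "degree s \<le> degree P" by (rule dvd_imp_degree_le[OF sP])
    moreover have "coeff P (degree P) \<noteq> 0" using \<open>P \<noteq> 0\<close> by simp
    ultimately show False unfolding cP by simp
  qed
  then show ?thesis using cP[of i] i by simp
qed

text \<open>Modulo \<open>s\<close> the variable \<open>T\<close> has a polynomial inverse \<open>V\<close>. Writing \<open>f = T\<^sup>-\<^sup>N F\<close> with a polynomial
  \<open>F\<close>, the remainder of \<open>V\<^sup>N F\<close> modulo \<open>s\<close> represents \<open>f\<close>.\<close>

lemma laurent_rep_exists:
  fixes s :: "'k::field poly"
  assumes s0: "coeff s 0 \<noteq> 0"
  shows "\<exists>a. laurent_of_poly s dvd f - (\<Sum>i<degree s. Poly_Mapping.single (int i) (a i))"
proof -
  obtain c s' where s: "s = pCons c s'" by (cases s)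
  have c: "c \<noteq> 0" using s0 s by simp
  \<comment> \<open>From \<open>s = c + T s'\<close> one reads off \<open>T * (- s' / c) = 1 - s / c\<close>.\<close>
  define V where "V = Polynomial.smult (- inverse c) s'"
  have xV: "s dvd 1 - monom 1 1 * V"
  proof -
    have "1 - monom 1 1 * V = s * [:inverse c:]"
      unfolding s V_def using c by (simp add: monom_Suc monom_0 one_pCons)
    then show ?thesis by (rule dvdI)
  qed
  obtain N F where F: "Poly_Mapping.single (int N) 1 * f = laurent_of_poly F"
    using laurent_shift_poly by blast
  have unit: "Poly_Mapping.single (- int N) 1 * (Poly_Mapping.single (int N) 1 * g) = g" for g :: "'k laurent_poly"
    by (simp add: mult_single flip: mult.assoc)
  have "1 - monom 1 1 * V dvd 1 - (monom 1 1 * V) ^ N"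
    using power_diff_sumr2[of 1 N "monom 1 1 * V"] by simp
  then have xVN: "s dvd 1 - monom 1 N * V ^ N"
    using dvd_trans[OF xV] by (simp add: power_mult_distrib monom_power)
  define P where "P = (V ^ N * F) mod s"
  have "s dvd (1 - monom 1 N * V ^ N) * F + monom 1 N * (s * ((V ^ N * F) div s))"
    using xVN by (intro dvd_add dvd_mult dvd_mult2) auto
  also have "\<dots> = F - monom 1 N * P"
    unfolding P_def minus_mult_div_eq_mod[symmetric] by (simp add: algebra_simps)
  finally obtain Q where "F - monom 1 N * P = s * Q" by (elim dvdE)
  then have "laurent_of_poly (F - monom 1 N * P) = laurent_of_poly (s * Q)" by simp
  then have "Poly_Mapping.single (int N) 1 * (f - laurent_of_poly P) = laurent_of_poly s * laurent_of_poly Q"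
    unfolding laurent_of_poly_diff laurent_of_poly_mult F[symmetric] laurent_of_poly_monom
    by (simp add: algebra_simps)
  then have "f - laurent_of_poly P = laurent_of_poly s * (Poly_Mapping.single (- int N) 1 * laurent_of_poly Q)"
    using unit[of "f - laurent_of_poly P"] by (simp add: ac_simps)
  then have d: "laurent_of_poly s dvd f - laurent_of_poly P" by simp
  have Pdeg: "P = 0 \<or> degree P < degree s"
    unfolding P_def by (rule degree_mod_less) (use s0 in auto)
  have "laurent_of_poly P = (\<Sum>i<degree s. Poly_Mapping.single (int i) (coeff P i))"
  proof (cases "P = 0")
    case False
    then show ?thesis unfolding laurent_of_poly_def using Pdeg
      by (intro sum.mono_neutral_left) (auto simp: coeff_eq_0)
  qed simp
  with d show ?thesis by auto
qed

lemma laurent_coset_eq_iff: "laurent_coset h f = laurent_coset h g \<longleftrightarrow> h dvd f - g"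
proof
  assume "laurent_coset h f = laurent_coset h g"
  moreover have "f \<in> laurent_coset h f" by (simp add: laurent_coset_def)
  ultimately have "f \<in> laurent_coset h g" by (simp only:)
  then show "h dvd f - g" unfolding laurent_coset_def by simp
next
  assume d: "h dvd f - g"
  have "h dvd x - f \<longleftrightarrow> h dvd x - g" for x
  proof -
    have "x - f + (f - g) = x - g" by (simp only: add_diff_eq diff_add_cancel)
    with dvd_add_left_iff[OF d, of "x - f"] show ?thesis by (simp only:)
  qed
  then show "laurent_coset h f = laurent_coset h g" unfolding laurent_coset_def by simp
qed

lemma coset_add_coset:
  "coset_add h (laurent_coset h f) (laurent_coset h g) = laurent_coset h (f + g)"
proof -
  have "laurent_coset h (x + y) = laurent_coset h (f + g)" 
    if "x \<in> laurent_coset h f" "y \<in> laurent_coset h g" for x y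
    using that dvd_add[of h "x - f" "y - g"] unfolding laurent_coset_eq_iff
    by (simp add: laurent_coset_def algebra_simps)
  moreover have "f \<in> laurent_coset h f" for f unfolding laurent_coset_def by simp
  ultimately show ?thesis unfolding coset_add_def by blast
qed

lemma coset_scale_coset:
  "coset_scale h c (laurent_coset h f) = laurent_coset h (Poly_Mapping.single 0 c * f)"
proof -
  have "laurent_coset h (Poly_Mapping.single 0 c * x) = laurent_coset h (Poly_Mapping.single 0 c * f)" 
    if "x \<in> laurent_coset h f" for x
    using that dvd_mult[of h "x - f" "Poly_Mapping.single 0 c"] unfolding laurent_coset_eq_iff
    by (simp add: laurent_coset_def algebra_simps)
  moreover have "f \<in> laurent_coset h f" for f unfolding laurent_coset_def by simp
  ultimately show ?thesis unfolding coset_scale_def by blast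
qed

lemma coset_coords_eq:
  fixes s :: "'k::field poly"
  assumes "coeff s 0 \<noteq> 0"
  shows "coset_coords (degree s) (laurent_coset (laurent_of_poly s) (\<Sum>i<degree s. Poly_Mapping.single (int i) (a i))) = vec (degree s) a"
  unfolding coset_coords_def
proof (rule the_equality)
  show "vec (degree s) a \<in> carrier_vec (degree s) \<and> 
    (\<Sum>i<degree s. Poly_Mapping.single (int i) (vec (degree s) a $ i))
    \<in> laurent_coset (laurent_of_poly s) (\<Sum>i<degree s. Poly_Mapping.single (int i) (a i))"
    by (simp add: laurent_coset_def)
next
  fix b assume b: "b \<in> carrier_vec (degree s) \<and> 
    (\<Sum>i<degree s. Poly_Mapping.single (int i) (b $ i))
    \<in> laurent_coset (laurent_of_poly s) (\<Sum>i<degree s. Poly_Mapping.single (int i) (a i))"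
  then have "b $ i = a i" if "i < degree s" for i
    using laurent_rep_unique[OF assms _ that, of "\<lambda>i. b $ i" a] by (simp add: laurent_coset_def)
  then show "b = vec (degree s) a" using b by (intro eq_vecI) auto
qed

section \<open>An isometry with a cyclic vector\<close>

locale cyclic_isometry = finite_dimensional_vector_space scale Basis
  for scale :: "'k::field \<Rightarrow> 'v::ab_group_add \<Rightarrow> 'v" and Basis +
  fixes \<Psi> :: "'v \<Rightarrow> 'v \<Rightarrow> 'k" and \<epsilon> :: 'k and \<gamma> :: "'v \<Rightarrow> 'v" and v0 :: 'v
  assumes eps_square: "\<epsilon> * \<epsilon> = 1"
    and bilinear: "bilinear_form scale \<Psi>"
    and symmetric: "eps_symmetric \<epsilon> \<Psi>"
    and nondegenerate: "nondegenerate \<Psi>"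
    and isometry: "is_isometry (type_space scale \<Psi>) (type_space scale \<Psi>) \<gamma>"
    and norm_v0: "\<Psi> v0 v0 = 1 + \<epsilon>"
    and cyclic: "span (range (\<lambda>i::nat. (\<gamma> ^^ i) v0)) = UNIV"
begin

abbreviation "orb i \<equiv> (\<gamma> ^^ i) v0"
abbreviation "\<delta> \<equiv> \<gamma> \<circ> eps_reflection scale \<Psi> v0"
abbreviation "q \<equiv> endo_char_poly scale \<gamma>"
abbreviation "p \<equiv> endo_char_poly scale \<delta>"

definition moment :: "nat \<Rightarrow> 'k" where "moment m = \<Psi> v0 (orb m)"

text \<open>The coefficient of \<open>T\<^sup>m\<close> in the vector polynomial \<open>q(T) (T - \<gamma>)\<^sup>-\<^sup>1 \<gamma> v0\<close>. Summing up to the full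
  \<open>dimension\<close> for every \<open>m\<close> only adds zero terms, and makes shifting \<open>m\<close> painless.\<close>

definition resolvent_coeff :: "nat \<Rightarrow> 'v" where
  "resolvent_coeff m = (\<Sum>i\<le>dimension. scale (coeff q (Suc (m + i))) (orb (Suc i)))"

text \<open>This will turn out to be \<open>w(1/T)\<close>, that is, the expansion of \<open>w = p/q\<close> at infinity. The constant
  term is 1 rather than \<open>\<Psi>(v0, v0)\<close>.\<close>

definition moment_series :: "'k fps" where "moment_series = Abs_fps (\<lambda>m. if m = 0 then 1 else moment m)"

lemma form_linear: "Vector_Spaces.linear scale (*) (\<Psi> u)" "Vector_Spaces.linear scale (*) (\<lambda>v. \<Psi> v u)"
  using bilinear unfolding bilinear_form_def by auto

sublocale form: Vector_Spaces.linear scale "(*)" "\<Psi> u" for u by (rule form_linear)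
sublocale form_left: Vector_Spaces.linear scale "(*)" "\<lambda>v. \<Psi> v u" for u by (rule form_linear)

lemma bij_gamma: "bij \<gamma>"
  and form_invariant: "\<Psi> (\<gamma> u) (\<gamma> v) = \<Psi> u v"
  using isometry unfolding is_isometry_def type_space_def by auto

sublocale gamma: Vector_Spaces.linear scale scale \<gamma>
  using isometry unfolding is_isometry_def type_space_def by unfold_locales auto

lemma form_funpow: "\<Psi> ((\<gamma> ^^ m) u) ((\<gamma> ^^ m) v) = \<Psi> u v"
  by (induction m) (auto simp: form_invariant)

lemma form_orb: "\<Psi> (orb i) (orb j) = (if i \<le> j then moment (j - i) else \<epsilon> * moment (i - j))"
proof -
  have le: "\<Psi> (orb i) (orb j) = moment (j - i)" if "i \<le> j" for i j
  proof -
    have "orb j = (\<gamma> ^^ i) (orb (j - i))"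
      using that by (simp flip: funpow_add o_apply[of "\<gamma> ^^ i"])
    then show ?thesis by (simp add: form_funpow moment_def)
  qed
  have "\<Psi> (orb i) (orb j) = \<epsilon> * \<Psi> (orb j) (orb i)"
    using symmetric unfolding eps_symmetric_def by blast
  then show ?thesis using le[of i j] le[of j i] by auto
qed

lemma moment_0: "moment 0 = 1 + \<epsilon>"
  by (simp add: moment_def norm_v0)

lemma delta_apply: "\<delta> v = \<gamma> v - scale (\<Psi> v0 v) (\<gamma> v0)"
  by (simp add: eps_reflection_def gamma.diff gamma.scale)

lemma delta_linear: "Vector_Spaces.linear scale scale \<delta>"
proof unfold_locales
  fix a x y
  show "\<delta> (x + y) = \<delta> x + \<delta> y" unfolding delta_apply
    by (simp add: gamma.add form.add scale_left_distrib)
  show "\<delta> (scale a x) = scale a (\<delta> x)" unfolding delta_apply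
    by (simp add: gamma.scale form.scale scale_right_diff_distrib)
qed

text \<open>On a \<open>\<delta>\<close>-stable space containing \<open>\<gamma> v0\<close>, the maps \<open>\<gamma>\<close> and \<open>\<delta>\<close> differ by vectors of that space, so
  it is also \<open>\<gamma>\<close>-stable and contains all \<open>\<gamma>\<^sup>i v0\<close> with \<open>i > 0\<close>; these span as \<open>\<gamma>\<close> is onto.\<close>

lemma delta_cyclic: "span (range (\<lambda>i. (\<delta> ^^ i) (\<gamma> v0))) = UNIV"
proof -
  interpret d: Vector_Spaces.linear scale scale \<delta> by (rule delta_linear)
  define S where "S = span (range (\<lambda>i. (\<delta> ^^ i) (\<gamma> v0)))"
  have sub: "subspace S" unfolding S_def by (rule subspace_span)
  have base: "(\<delta> ^^ i) (\<gamma> v0) \<in> S" for i unfolding S_def by (intro span_base) auto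
  have dS: "\<delta> u \<in> S" if "u \<in> S" for u
    using that unfolding S_def
  proof (induction rule: span_induct_alt)
    case base
    show ?case by (simp only: d.zero span_zero)
  next
    case (step c y z)
    then obtain i where "y = (\<delta> ^^ i) (\<gamma> v0)" by auto
    then have "\<delta> y \<in> S" using base[of "Suc i"] by simp
    then show ?case using step(2) unfolding S_def[symmetric] d.add d.scale
      by (intro subspace_add[OF sub] subspace_scale[OF sub])
  qed
  have gS: "\<gamma> u \<in> S" if "u \<in> S" for u
  proof -
    have "\<gamma> u = \<delta> u + scale (\<Psi> v0 u) (\<gamma> v0)" unfolding delta_apply by simp
    also have "\<dots> \<in> S"
      using dS[OF that] base[of 0] by (intro subspace_add[OF sub] subspace_scale[OF sub]) auto
    finally show ?thesis .
  qed
  have orb: "\<gamma> (orb i) \<in> S" for i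
    by (induction i) (use base[of 0] gS in auto)
  have "UNIV = \<gamma> ` span (range orb)" using bij_gamma cyclic by (simp add: bij_is_surj)
  also have "\<dots> = span (\<gamma> ` range orb)" by (rule gamma.span_image[symmetric])
  also have "\<dots> \<subseteq> S" by (rule span_minimal[OF _ sub]) (use orb in auto)
  finally show ?thesis unfolding S_def by auto
qed

lemma coeff_q_large: "m > dimension \<Longrightarrow> coeff q m = 0"
  using endo_char_poly_degree[of \<gamma>] by (simp add: coeff_eq_0)

lemma annihilated: "(\<Sum>i\<le>dimension. scale (coeff q i) (orb i)) = 0"
  using cayley_hamilton[OF gamma.linear_axioms, of v0] poly_act_eq[of q dimension \<gamma> v0]
  by (simp add: endo_char_poly_degree)

lemma resolvent_0: "\<gamma> (resolvent_coeff 0) = - scale (coeff q 0) (\<gamma> v0)"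
proof -
  have "(\<Sum>i\<le>Suc dimension. scale (coeff q i) (orb i)) = scale (coeff q 0) v0 + resolvent_coeff 0"
    unfolding resolvent_coeff_def by (subst sum.atMost_Suc_shift) simp
  then have "resolvent_coeff 0 = - scale (coeff q 0) v0"
    using annihilated coeff_q_large[of "Suc dimension"] by (simp add: eq_neg_iff_add_eq_0 add.commute)
  then show ?thesis by (simp add: gamma.neg gamma.scale)
qed

lemma resolvent_Suc: "resolvent_coeff m - \<gamma> (resolvent_coeff (Suc m)) = scale (coeff q (Suc m)) (\<gamma> v0)"
proof -
  define h where "h i = scale (coeff q (Suc (m + i))) (orb (Suc i))" for i
  have "h (Suc dimension) = 0" unfolding h_def by (simp add: coeff_q_large)
  then have "resolvent_coeff m = (\<Sum>i\<le>Suc dimension. h i)" unfolding resolvent_coeff_def h_def by simp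
  also have "\<dots> = h 0 + (\<Sum>i\<le>dimension. h (Suc i))" by (rule sum.atMost_Suc_shift)
  also have "(\<Sum>i\<le>dimension. h (Suc i)) = \<gamma> (resolvent_coeff (Suc m))"
    unfolding resolvent_coeff_def h_def by (simp add: gamma.sum gamma.scale)
  finally show ?thesis by (simp add: h_def)
qed

lemma resolvent_large: "m \<ge> dimension \<Longrightarrow> resolvent_coeff m = 0"
  unfolding resolvent_coeff_def by (simp add: coeff_q_large)

text \<open>Coefficientwise form of \<open>p = q * (1 + \<Psi>(v0, (T - \<gamma>)\<^sup>-\<^sup>1 \<gamma> v0))\<close>, the determinant formula for a rank one
  perturbation. It is obtained without determinants: the right side is a monic polynomial of degree
  \<open>dim V\<close>, the recursion for \<^const>\<open>resolvent_coeff\<close> with respect to \<open>\<gamma>\<close> turns into one for \<open>\<delta>\<close> with these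
  coefficients, and so the right side annihilates the \<open>\<delta>\<close>-cyclic vector \<open>\<gamma> v0\<close>. So does \<open>p\<close>, and only
  one monic polynomial of that degree can.\<close>

lemma coeff_p: "coeff p m = coeff q m + \<Psi> v0 (resolvent_coeff m)"
proof (cases "m < dimension")
  case False
  then show ?thesis
    using endo_char_poly_degree[of \<gamma>] endo_char_poly_degree[of \<delta>]
    by (cases "m = dimension") (auto simp: resolvent_large form.zero coeff_eq_0)
next
  case True
  define a where "a m = coeff q m + \<Psi> v0 (resolvent_coeff m)" for m
  have d0: "\<delta> (resolvent_coeff 0) = - scale (a 0) (\<gamma> v0)"
    unfolding delta_apply resolvent_0 a_def by (simp add: scale_left_distrib)
  have dS: "resolvent_coeff m - \<delta> (resolvent_coeff (Suc m)) = scale (a (Suc m)) (\<gamma> v0)" for m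
    using resolvent_Suc[of m] unfolding delta_apply a_def by (simp add: scale_left_distrib algebra_simps)
  have "(\<Sum>m\<le>dimension. scale (a m) ((\<delta> ^^ m) (\<gamma> v0))) = - (\<delta> ^^ Suc dimension) (resolvent_coeff dimension)"
    by (rule horner_telescope[OF delta_linear d0 dS])
  also have "\<dots> = 0"
    using module_hom.zero[OF Vector_Spaces.linear.axioms(3)[OF linear_funpow[OF delta_linear]], of "Suc dimension"]
    by (simp add: resolvent_large del: funpow.simps o_apply)
  finally have sa: "(\<Sum>m\<le>dimension. scale (a m) ((\<delta> ^^ m) (\<gamma> v0))) = 0" .
  have sp: "(\<Sum>m\<le>dimension. scale (coeff p m) ((\<delta> ^^ m) (\<gamma> v0))) = 0"
    using cayley_hamilton[OF delta_linear, of "\<gamma> v0"] poly_act_eq[of p dimension \<delta> "\<gamma> v0"]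
    by (simp add: endo_char_poly_degree)
  have top: "a dimension = coeff p dimension"
    unfolding a_def by (simp add: resolvent_large form.zero endo_char_poly_degree)
  have "(\<Sum>m\<le>dimension. scale (coeff p m - a m) ((\<delta> ^^ m) (\<gamma> v0))) = 0"
    using sa sp by (simp only: scale_left_diff_distrib sum_subtractf diff_self)
  then have "(\<Sum>m<dimension. scale (coeff p m - a m) ((\<delta> ^^ m) (\<gamma> v0))) = 0"
    unfolding lessThan_Suc_atMost[symmetric] sum.lessThan_Suc top by simp
  from spanning_family_independent[OF orbit_spans[OF delta_linear delta_cyclic] this True]
  show ?thesis by (simp add: a_def)
qed

text \<open>Apply the isometry \<open>\<gamma>\<^sup>m\<^sup>+\<^sup>1\<close> to both arguments of the form. The second one becomes the boundary term of
  a truncated substitution, a combination of the vectors \<open>\<gamma>\<^sup>j\<^sup>+\<^sup>1 v0\<close> with \<open>j \<le> m\<close>.\<close>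

lemma form_resolvent: "\<Psi> v0 (resolvent_coeff m) = - (\<Sum>j\<le>m. coeff q j * \<Psi> (orb m) (orb j))"
proof -
  have h: "(\<Sum>j\<le>m. scale (coeff q j) ((\<gamma> ^^ j) (\<gamma> v0))) = - (\<gamma> ^^ Suc m) (resolvent_coeff m)"
    by (rule horner_telescope[OF gamma.linear_axioms resolvent_0 resolvent_Suc])
  have "\<Psi> v0 (resolvent_coeff m) = \<Psi> ((\<gamma> ^^ Suc m) v0) ((\<gamma> ^^ Suc m) (resolvent_coeff m))"
    by (rule form_funpow[symmetric])
  also have "(\<gamma> ^^ Suc m) (resolvent_coeff m) = - (\<Sum>j\<le>m. scale (coeff q j) (\<gamma> (orb j)))"
    using h by (simp add: funpow_swap1)
  also have "\<Psi> ((\<gamma> ^^ Suc m) v0) \<dots> = - (\<Sum>j\<le>m. coeff q j * \<Psi> (orb m) (orb j))"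
    by (simp add: form.neg form.sum form.scale form_invariant)
  finally show ?thesis .
qed

text \<open>The expansion of \<open>p/q\<close> at 0: it is \<open>-\<epsilon>\<close> times the moment series, because moving the resolvent
  past the isometry replaces \<open>\<gamma>\<close> by its inverse and symmetry of the form contributes the \<open>\<epsilon>\<close>. At the
  constant term \<open>1 - \<Psi>(v0, v0) = -\<epsilon>\<close>.\<close>

lemma p_expansion: "fps_of_poly p = fps_const (- \<epsilon>) * (fps_of_poly q * moment_series)"
proof (rule fps_ext)
  fix m
  have "(\<Sum>j\<le>m. coeff q j * \<Psi> (orb m) (orb j)) = \<epsilon> * (\<Sum>j<m. coeff q j * moment (m - j)) + coeff q m * (1 + \<epsilon>)"
    unfolding lessThan_Suc_atMost[symmetric] sum.lessThan_Suc sum_distrib_left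
    by (intro arg_cong2[of _ _ _ _ "(+)"] sum.cong) (simp_all add: form_orb moment_0)
  moreover have "a - (\<epsilon> * S + a * (1 + \<epsilon>)) = - \<epsilon> * (S + a)" for a S
    by (simp add: algebra_simps)
  ultimately have l: "coeff p m = - \<epsilon> * ((\<Sum>j<m. coeff q j * moment (m - j)) + coeff q m)"
    unfolding coeff_p form_resolvent by (simp only: add_uminus_conv_diff)
  have "(\<Sum>j\<le>m. coeff q j * fps_nth moment_series (m - j)) = (\<Sum>j<m. coeff q j * moment (m - j)) + coeff q m"
    unfolding lessThan_Suc_atMost[symmetric] sum.lessThan_Suc by (simp add: moment_series_def)
  then show "fps_nth (fps_of_poly p) m = fps_nth (fps_const (- \<epsilon>) * (fps_of_poly q * moment_series)) m"
    using l unfolding fps_mult_left_const_nth by (simp add: fps_mult_nth atLeast0AtMost)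
qed

text \<open>The expansion of \<open>p/q\<close> at infinity. Inverting \<open>T - \<gamma>\<close> as a power series in \<open>1/T\<close> involves only
  nonnegative powers of \<open>\<gamma>\<close>, so the moments appear directly, without a sign.\<close>

lemma reflect_p_expansion: "fps_of_poly (reflect_poly p) = fps_of_poly (reflect_poly q) * moment_series"
proof (rule fps_ext)
  fix k
  show "fps_nth (fps_of_poly (reflect_poly p)) k = fps_nth (fps_of_poly (reflect_poly q) * moment_series) k"
  proof (cases "k \<le> dimension")
    case True
    define m where "m = dimension - k"
    have "fps_nth (fps_of_poly (reflect_poly q) * moment_series) k = (\<Sum>j\<le>k. coeff q (dimension - j) * fps_nth moment_series (k - j))"
      unfolding fps_mult_nth atLeast0AtMost
      by (rule sum.cong) (use True in \<open>auto simp: coeff_reflect_poly endo_char_poly_degree\<close>)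
    also have "\<dots> = (\<Sum>i\<le>k. coeff q (m + i) * fps_nth moment_series i)"
      by (rule sum.reindex_bij_witness[of _ "\<lambda>i. k - i" "\<lambda>i. k - i"]) (use True in \<open>auto simp: m_def\<close>)
    also have "\<dots> = (\<Sum>i\<le>Suc dimension. coeff q (m + i) * fps_nth moment_series i)"
      by (rule sum.mono_neutral_left) (use True in \<open>auto simp: m_def coeff_q_large\<close>)
    also have "\<dots> = coeff q m + \<Psi> v0 (resolvent_coeff m)"
      unfolding resolvent_coeff_def by (subst sum.atMost_Suc_shift) (simp add: moment_series_def form.sum form.scale moment_def)
    also have "\<dots> = fps_nth (fps_of_poly (reflect_poly p)) k"
      using True by (simp add: coeff_p m_def coeff_reflect_poly endo_char_poly_degree)
    finally show ?thesis ..
  next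
    case False
    \<comment> \<open>Beyond the degree, the coefficients vanish because \<open>q(\<gamma>)\<close> does.\<close>
    have "fps_nth (fps_of_poly (reflect_poly q) * moment_series) k = (\<Sum>j\<le>dimension. coeff q (dimension - j) * fps_nth moment_series (k - j))"
      unfolding fps_mult_nth atLeast0AtMost
      by (rule sum.mono_neutral_cong_right) (use False in \<open>auto simp: coeff_reflect_poly endo_char_poly_degree\<close>)
    also have "\<dots> = (\<Sum>i\<le>dimension. coeff q i * moment (k - dimension + i))"
      by (rule sum.reindex_bij_witness[of _ "\<lambda>i. dimension - i" "\<lambda>i. dimension - i"]) (use False in \<open>auto simp: moment_series_def\<close>)
    also have "\<dots> = \<Psi> v0 ((\<gamma> ^^ (k - dimension)) (\<Sum>i\<le>dimension. scale (coeff q i) (orb i)))"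
    proof -
      interpret gn: Vector_Spaces.linear scale scale "\<gamma> ^^ (k - dimension)"
        by (rule linear_funpow[OF gamma.linear_axioms])
      show ?thesis by (simp add: gn.sum gn.scale form.sum form.scale moment_def funpow_add)
    qed
    also have "\<dots> = 0" unfolding annihilated
      using module_hom.zero[OF Vector_Spaces.linear.axioms(3)[OF linear_funpow[OF gamma.linear_axioms]]]
      by (simp add: form.zero)
    finally show ?thesis using False by (simp add: coeff_reflect_poly endo_char_poly_degree)
  qed
qed

lemma orb_independent:
  "(\<Sum>i<dimension. scale (a i) (orb i)) = 0 \<Longrightarrow> i < dimension \<Longrightarrow> a i = 0"
  by (rule spanning_family_independent[OF orbit_spans[OF gamma.linear_axioms cyclic]])

lemma q_nonzero: "q \<noteq> 0"
  using endo_char_poly_degree(2)[of \<gamma>] by auto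

text \<open>Otherwise, as \<open>\<gamma>\<close> is injective, \<open>q(T)/T\<close> would already annihilate \<open>v0\<close>.\<close>

lemma coeff_q_0: "coeff q 0 \<noteq> 0"
proof
  assume q0: "coeff q 0 = 0"
  then have n: "dimension > 0" using endo_char_poly_degree(2)[of \<gamma>] by (cases "dimension = 0") auto
  then obtain d where d: "dimension = Suc d" by (cases dimension) auto
  have "0 = (\<Sum>i\<le>Suc d. scale (coeff q i) (orb i))" using annihilated d by simp
  also have "\<dots> = \<gamma> (\<Sum>i<dimension. scale (coeff q (Suc i)) (orb i))"
    unfolding sum.atMost_Suc_shift d lessThan_Suc_atMost by (simp add: q0 gamma.sum gamma.scale)
  finally have "(\<Sum>i<dimension. scale (coeff q (Suc i)) (orb i)) = 0"
    using injD[OF bij_is_inj[OF bij_gamma]] gamma.zero by metis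
  from orb_independent[OF this, of d] show False
    using d endo_char_poly_degree(2)[of \<gamma>] by simp
qed

lemma smult_p_expansion: "fps_of_poly (Polynomial.smult (- \<epsilon>) p) = fps_of_poly q * moment_series"
proof -
  have "fps_const (- \<epsilon>) * fps_const (- \<epsilon>) = 1" using eps_square by simp
  then show ?thesis unfolding fps_of_poly_smult p_expansion mult.assoc[symmetric] by (simp only: mult_1_left)
qed

text \<open>The functional equation \<open>w(1/T) = -\<epsilon> w(T)\<close>: both expansions are multiples of one power series.\<close>

lemma functional_equation: "reflect_poly p * q = Polynomial.smult (- \<epsilon>) p * reflect_poly q"
proof -
  have "fps_of_poly (reflect_poly p * q) = fps_of_poly (Polynomial.smult (- \<epsilon>) p * reflect_poly q)"
    unfolding fps_of_poly_mult reflect_p_expansion smult_p_expansion by (simp only: ac_simps)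
  then show ?thesis by (simp add: fps_of_poly_eq_iff)
qed

text \<open>The vectors \<open>\<gamma>\<^sup>m v0\<close> with \<open>m \<ge> N\<close> still span, being the image of all of them under the bijection
  \<open>\<gamma>\<^sup>N\<close>.\<close>

lemma orthogonal_to_tail:
  assumes "\<And>m. m \<ge> N \<Longrightarrow> \<Psi> (orb m) z = 0"
  shows "z = 0"
proof -
  interpret gn: Vector_Spaces.linear scale scale "\<gamma> ^^ N"
    by (rule linear_funpow[OF gamma.linear_axioms])
  have "\<Psi> ((\<gamma> ^^ N) u) z = 0" for u
  proof -
    have "u \<in> span (range orb)" using cyclic by simp
    then show ?thesis
    proof (induction rule: span_induct_alt)
      case base
      then show ?case by (simp add: gn.zero form_left.zero)
    next
      case (step c x y)
      then obtain i where "x = orb i" by auto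
      then have "\<Psi> ((\<gamma> ^^ N) x) z = 0" using assms[of "N + i"] by (simp add: funpow_add)
      then show ?case using step by (simp add: gn.add gn.scale form_left.add form_left.scale)
    qed
  qed
  moreover have "surj (\<gamma> ^^ N)" using bij_gamma by (simp add: bij_is_surj surj_fn)
  ultimately have "\<Psi> u z = 0" for u by (metis surjD)
  then show ?thesis using nondegenerate unfolding nondegenerate_def by blast
qed

text \<open>A common factor of positive degree leaves \<open>p/q = p'/q'\<close> with \<open>deg q' < dim V\<close>, so the moments satisfy
  a linear recurrence that short. It says that \<open>q'(\<gamma>) v0\<close> is orthogonal to \<open>\<gamma>\<^sup>m v0\<close> for all large \<open>m\<close>.
  Hence \<open>q'(\<gamma>) v0 = 0\<close>, against the independence of the powers below \<open>dim V\<close>.\<close>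

lemma coprime_p_q: "coprime p q"
proof (rule coprimeI)
  fix g assume "g dvd p" "g dvd q"
  then obtain p' q' where p': "p = g * p'" and q': "q = g * q'" by (auto elim!: dvdE)
  have nz: "g \<noteq> 0" "q' \<noteq> 0" using q' q_nonzero by auto
  have "p \<noteq> 0" using endo_char_poly_degree(2)[of \<delta>] by auto
  then have nz': "p' \<noteq> 0" using p' by auto
  have deg: "dimension = degree g + degree q'" "dimension = degree g + degree p'"
    using endo_char_poly_degree(1)[of \<gamma>] endo_char_poly_degree(1)[of \<delta>] p' q' nz nz'
    by (metis degree_mult_eq)+
  have "fps_of_poly g * fps_of_poly p' = fps_of_poly g * (fps_const (- \<epsilon>) * (fps_of_poly q' * moment_series))"
    using p_expansion unfolding p' q' fps_of_poly_mult by (simp add: ac_simps)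
  then have pq: "fps_of_poly p' = fps_const (- \<epsilon>) * (fps_of_poly q' * moment_series)"
    using nz(1) fps_of_poly_eq_iff[of g 0] by simp
  have "degree g = 0"
  proof (rule ccontr)
    assume "degree g \<noteq> 0"
    then have d: "degree q' < dimension" "degree p' = degree q'" using deg by auto
    define z where "z = (\<Sum>j\<le>degree q'. scale (coeff q' j) (orb j))"
    have "\<Psi> (orb m) z = 0" if m: "m \<ge> Suc (degree q')" for m
    proof -
      have "0 = - fps_nth (fps_of_poly p') m" using m d by (simp add: coeff_eq_0)
      also have "\<dots> = \<epsilon> * (\<Sum>j\<le>m. coeff q' j * fps_nth moment_series (m - j))"
        unfolding pq fps_mult_left_const_nth by (simp add: fps_mult_nth atLeast0AtMost)
      also have "(\<Sum>j\<le>m. coeff q' j * fps_nth moment_series (m - j)) = (\<Sum>j\<le>degree q'. coeff q' j * moment (m - j))"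
        by (rule sum.mono_neutral_cong_right) (use m in \<open>auto simp: coeff_eq_0 moment_series_def\<close>)
      also have "\<epsilon> * \<dots> = (\<Sum>j\<le>degree q'. coeff q' j * \<Psi> (orb m) (orb j))"
        unfolding sum_distrib_left by (rule sum.cong) (use m in \<open>auto simp: form_orb\<close>)
      also have "\<dots> = \<Psi> (orb m) z" by (simp add: z_def form.sum form.scale)
      finally show ?thesis ..
    qed
    then have "z = 0" by (rule orthogonal_to_tail)
    moreover have "z = (\<Sum>j<dimension. scale (coeff q' j) (orb j))"
      unfolding z_def by (rule sum.mono_neutral_left) (use d in \<open>auto simp: coeff_eq_0\<close>)
    ultimately have "coeff q' (degree q') = 0" using orb_independent d(1) by metis
    then show False using nz by simp
  qed
  then show "is_unit g" using nz by (simp add: is_unit_iff_degree)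
qed

lemma lead_coeff_q: "lead_coeff q = 1"
  by (simp add: endo_char_poly_degree)

lemma lowest_terms_pq: "lowest_terms (Fract p q) = (p, q)"
  by (rule lowest_terms_Fract[OF coprime_p_q lead_coeff_q])

lemma eps_nonzero: "\<epsilon> \<noteq> 0" using eps_square by auto

lemma at_inverse_pq: "rat_at_inverse (Fract p q) = Fract (Polynomial.smult (- \<epsilon>) p) q"
  using rat_at_inverse_Fract[OF coprime_p_q lead_coeff_q] functional_equation q_nonzero
  by (simp add: endo_char_poly_degree eq_fract)

lemma lowest_terms_at_inverse:
  "lowest_terms (rat_at_inverse (Fract p q)) = (Polynomial.smult (- \<epsilon>) p, q)"
proof -
  have "coprime (Polynomial.smult (- \<epsilon>) p) q"
    using coprime_p_q eps_nonzero unfolding coprime_def by (simp add: dvd_smult_iff)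
  then show ?thesis unfolding at_inverse_pq by (rule lowest_terms_Fract[OF _ lead_coeff_q])
qed

lemma fps_q_nonzero: "fps_of_poly q \<noteq> 0"
  using q_nonzero fps_of_poly_eq_iff[of q 0] by simp

lemma expansion_zero: "expansion_at_zero (Fract p q) = fps_const (- \<epsilon>) * moment_series"
proof -
  have "fps_of_poly p = (fps_const (- \<epsilon>) * moment_series) * fps_of_poly q"
    by (simp add: p_expansion ac_simps)
  then show ?thesis
    unfolding expansion_at_zero_def rat_num_def rat_denom_def lowest_terms_pq using fps_q_nonzero by simp
qed

lemma expansion_infinity: "expansion_at_infinity (Fract p q) = moment_series"
proof -
  have "fps_of_poly (Polynomial.smult (- \<epsilon>) p) = moment_series * fps_of_poly q"
    unfolding smult_p_expansion by (rule mult.commute)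
  then show ?thesis
    unfolding expansion_at_infinity_def expansion_at_zero_def rat_num_def rat_denom_def 
      lowest_terms_at_inverse using fps_q_nonzero by simp
qed

lemma admissible: "bezoutian_admissible \<epsilon> (Fract p q)"
  unfolding bezoutian_admissible_def
proof (intro conjI)
  show "regular_at_zero (Fract p q)"
    unfolding regular_at_zero_def rat_denom_def lowest_terms_pq by (simp add: poly_0_coeff_0 coeff_q_0)
  show "regular_at_infinity (Fract p q)"
    unfolding regular_at_infinity_def regular_at_zero_def rat_denom_def lowest_terms_at_inverse
    by (simp add: poly_0_coeff_0 coeff_q_0)
  show "rat_at_inverse (Fract p q) = rat_const (- \<epsilon>) * Fract p q"
    unfolding at_inverse_pq rat_const_def by simp
  show "fps_nth (expansion_at_infinity (Fract p q)) 0 = 1"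
    unfolding expansion_infinity moment_series_def by simp
qed

text \<open>The Toeplitz matrix of \<open>w\<close> is the Gram matrix of the basis \<open>v0, \<gamma> v0, \<gamma>\<^sup>2 v0, \<dots>\<close>.\<close>

lemma omega_eq_form: "bezoutian_omega (Fract p q) (int i - int j) = \<Psi> (orb i) (orb j)"
proof (cases i j rule: linorder_cases)
  case less
  then show ?thesis
    by (simp add: bezoutian_omega_def expansion_infinity moment_series_def form_orb nat_diff_distrib)
next
  case equal
  then show ?thesis
    by (simp add: bezoutian_omega_def expansion_infinity expansion_zero moment_series_def form_orb moment_0)
next
  case greater
  then show ?thesis
    by (simp add: bezoutian_omega_def expansion_zero moment_series_def form_orb nat_diff_distrib)
qed

text \<open>The isometry sends \<open>\<gamma>\<^sup>i v0\<close> to the class of \<open>T\<^sup>i\<close> for \<open>i < dim V\<close>.\<close>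

lemma isometric_bezoutian: "isometric (type_space scale \<Psi>) (skew_bezoutian (Fract p q))"
proof -
  define n where "n = dimension"
  define s where "s = reflect_poly q"
  define h where "h = laurent_of_poly s"
  have s0: "coeff s 0 \<noteq> 0" unfolding s_def using q_nonzero by simp
  have ds: "degree s = n" unfolding s_def n_def using coeff_q_0 by (simp add: endo_char_poly_degree)
  have rd: "rat_degree (Fract p q) = n"
    unfolding rat_degree_def rat_num_def rat_denom_def lowest_terms_pq n_def
    by (simp add: endo_char_poly_degree)
  define T where "T a = (\<Sum>i<n. Poly_Mapping.single (int i) (a i :: 'k))" for a
  have "\<exists>a. u = (\<Sum>i<n. scale (a i) (orb i))" for u
    using spanning_family_coords[OF orbit_spans[OF gamma.linear_axioms cyclic], of u]
    unfolding n_def by metis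
  then obtain co where co: "\<And>u. u = (\<Sum>i<n. scale (co u i) (orb i))" by metis
  have coI: "co u i = a i" if u: "u = (\<Sum>i<n. scale (a i) (orb i))" and "i < n" for u a i
  proof -
    have "(\<Sum>i<n. scale (co u i - a i) (orb i)) = 0"
      using co[of u] u by (simp add: scale_left_diff_distrib sum_subtractf)
    then show ?thesis using orb_independent[of "\<lambda>i. co u i - a i" i] \<open>i < n\<close> unfolding n_def by simp
  qed
  define f where "f u = laurent_coset h (T (co u))" for u
  have f_eq: "f u = laurent_coset h (T a)" if "u = (\<Sum>i<n. scale (a i) (orb i))" for u a
    unfolding f_def T_def using coI[OF that] by simp
  have inj: "inj f"
  proof (rule injI)
    fix u v assume "f u = f v"
    then have "co u i = co v i" if "i < n" for i
      using laurent_rep_unique[OF s0, of "co u" "co v" i] that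
      unfolding f_def laurent_coset_eq_iff T_def h_def ds by simp
    then show "u = v" using co[of u] co[of v] by simp
  qed
  have surj: "range f = range (laurent_coset h)"
  proof
    show "range f \<subseteq> range (laurent_coset h)" unfolding f_def by auto
    show "range (laurent_coset h) \<subseteq> range f"
    proof
      fix X assume "X \<in> range (laurent_coset h)"
      then obtain x where x: "X = laurent_coset h x" by auto
      obtain a where "h dvd x - T a"
        using laurent_rep_exists[OF s0, of x] unfolding h_def T_def ds by blast
      then have "X = laurent_coset h (T a)" unfolding x laurent_coset_eq_iff .
      also have "\<dots> = f (\<Sum>i<n. scale (a i) (orb i))" by (rule f_eq[OF refl, symmetric])
      finally show "X \<in> range f" by blast
    qed
  qed
  have add: "f (u + v) = coset_add h (f u) (f v)" for u v
  proof -
    have "u + v = (\<Sum>i<n. scale (co u i + co v i) (orb i))"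
      using co[of u] co[of v] by (simp add: scale_left_distrib sum.distrib)
    from f_eq[OF this] show ?thesis
      unfolding f_def coset_add_coset T_def by (simp add: single_add sum.distrib)
  qed
  have scl: "f (scale c u) = coset_scale h c (f u)" for c u
  proof -
    have "scale c u = scale c (\<Sum>i<n. scale (co u i) (orb i))" using co[of u] by simp
    also have "\<dots> = (\<Sum>i<n. scale (c * co u i) (orb i))" by (simp add: scale_sum_right)
    finally have "scale c u = (\<Sum>i<n. scale (c * co u i) (orb i))" .
    from f_eq[OF this] show ?thesis
      unfolding f_def coset_scale_coset T_def by (simp add: sum_distrib_left mult_single)
  qed
  have coords: "coset_coords n (f u) = vec n (co u)" for u
    unfolding f_def T_def h_def using coset_coords_eq[OF s0, of "co u"] unfolding ds .
  have form: "vec n (co u) \<bullet> (bezoutian_matrix (Fract p q) *\<^sub>v vec n (co v)) = \<Psi> u v" for u v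
  proof -
    have "vec n (co u) \<bullet> (bezoutian_matrix (Fract p q) *\<^sub>v vec n (co v))
        = (\<Sum>i<n. co u i * (\<Sum>j<n. \<Psi> (orb i) (orb j) * co v j))"
      unfolding bezoutian_matrix_def rd
      by (simp add: scalar_prod_def atLeast0LessThan omega_eq_form)
    also have "\<dots> = \<Psi> (\<Sum>i<n. scale (co u i) (orb i)) (\<Sum>j<n. scale (co v j) (orb j))"
      unfolding form_left.sum form_left.scale
      unfolding form.sum form.scale by (simp add: mult.commute)
    finally show ?thesis using co[of u] co[of v] by simp
  qed
  have "is_isometry (type_space scale \<Psi>) (skew_bezoutian (Fract p q)) f"
    unfolding is_isometry_def type_space_def skew_bezoutian_def Let_def rd
    unfolding rat_denom_def lowest_terms_pq snd_conv s_def[symmetric] h_def[symmetric]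
    using inj surj add scl by (simp add: bij_betw_def coords form)
  then show ?thesis unfolding isometric_def by blast
qed

end

theorem theorem3p3:
  fixes scale :: "'k::field \<Rightarrow> 'v::ab_group_add \<Rightarrow> 'v"
    and Basis :: "'v set"
    and \<Psi> :: "'v \<Rightarrow> 'v \<Rightarrow> 'k"
    and \<epsilon> :: 'k
    and \<gamma> :: "'v \<Rightarrow> 'v"
    and v0 :: 'v
  assumes "CHAR('k) \<noteq> 2"
    and "\<epsilon> \<in> {1, -1}"
    and "finite_dimensional_vector_space scale Basis"
    and "bilinear_form scale \<Psi>"
    and "eps_symmetric \<epsilon> \<Psi>"
    and "nondegenerate \<Psi>"
    and "is_isometry (type_space scale \<Psi>) (type_space scale \<Psi>) \<gamma>"
    and "\<Psi> v0 v0 = 1 + \<epsilon>"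
    and "module.span scale (range (\<lambda>i::nat. (\<gamma> ^^ i) v0)) = UNIV"
  defines "q \<equiv> endo_char_poly scale \<gamma>"
    and "p \<equiv> endo_char_poly scale (\<gamma> \<circ> eps_reflection scale \<Psi> v0)"
  shows "bezoutian_admissible \<epsilon> (Fract p q) \<and>
         isometric (type_space scale \<Psi>) (skew_bezoutian (Fract p q))"
proof -
  interpret finite_dimensional_vector_space scale Basis by fact
  interpret cyclic_isometry scale Basis \<Psi> \<epsilon> \<gamma> v0
    using assms by unfold_locales auto
  show ?thesis unfolding p_def q_def using admissible isometric_bezoutian by blast
qed

end
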